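(* Let $\lambda$ denote Lebesgue measure on $\mathbb{R}^2$, and let $\|(x,y)\|_1=|x|+|y|$ and $\|(x,y)\|_\infty=\max\{|x|,|y|\}$. Then $$\mathrm{DM}(\mathbb{R}^2,\|\cdot\|_1)=\mathrm{DM}(\mathbb{R}^2,\|\cdot\|_\infty)=\{\alpha\lambda:\alpha>0\}.$$
   Context: For a metric space $(X,d)$, write $B(x,r)=\{y\in X: d(y,x)<r\}$. A Borel regular measure $\mu$ on $X$ is doubling if there is a constant $C>0$ with $\mu(B(x,2r))\le C\mu(B(x,r))$ for all $x\in X$, $r>0$, and $0<\mu(B(x_0,r_0))<\infty$ for some $x_0\in X$, $r_0>0$ (then $0<\mu(B(x,r))<\infty$ for all $x\in X$, $r>0$). Its doubling constant is $C_\mu=\sup_{x\in X,\,r>0}\mu(B(x,2r))/\mu(B(x,r))$. The least doubling constant of $X$ is $C_X=\inf_\mu C_\mu$, the infimum being over all doubling measures on $X$. The set of doubling minimizers is $\mathrm{DM}(X,d)=\{\mu \text{ doubling measure on } X: C_\mu=C_X\}$; for a norm, the metric is the one it induces. *)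

theory Defs
  imports "HOL-Analysis.Analysis"
begin

text \<open>
  Metric spaces are given by a metric d on a whole type, with balls and topology taken from the
  locale \<^locale>\<open>Metric_space\<close>. Measures are understood as in geometric measure theory, as outer
  measures on all subsets: this is the setting in which ``Borel regular'' is a condition.
\<close>

definition borel_sets_of :: "('a \<Rightarrow> 'a \<Rightarrow> real) \<Rightarrow> 'a set set" where
  "borel_sets_of d = sigma_sets UNIV {U. openin (Metric_space.mtopology UNIV d) U}"

text \<open>
  The sets in \<^term>\<open>lambda_system UNIV UNIV \<mu>\<close> are the Caratheodory measurable sets; the second
  argument is the collection of all test sets, i.e. the power set of the space.
\<close>

definition borel_regular :: "('a \<Rightarrow> 'a \<Rightarrow> real) \<Rightarrow> ('a set \<Rightarrow> ennreal) \<Rightarrow> bool" where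
  "borel_regular d \<mu> \<longleftrightarrow>
     outer_measure_space UNIV \<mu> \<and>
     borel_sets_of d \<subseteq> lambda_system UNIV UNIV \<mu> \<and>
     (\<forall>A. \<exists>B \<in> borel_sets_of d. A \<subseteq> B \<and> \<mu> B = \<mu> A)"

definition doubling_measure :: "('a \<Rightarrow> 'a \<Rightarrow> real) \<Rightarrow> ('a set \<Rightarrow> ennreal) \<Rightarrow> bool" where
  "doubling_measure d \<mu> \<longleftrightarrow>
     borel_regular d \<mu> \<and>
     (\<exists>C::real. C > 0 \<and> (\<forall>x r. r > 0 \<longrightarrow>
        \<mu> (Metric_space.mball UNIV d x (2 * r)) \<le> ennreal C * \<mu> (Metric_space.mball UNIV d x r))) \<and>
     (\<exists>x\<^sub>0 r\<^sub>0. r\<^sub>0 > 0 \<and> 0 < \<mu> (Metric_space.mball UNIV d x\<^sub>0 r\<^sub>0) \<and>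
        \<mu> (Metric_space.mball UNIV d x\<^sub>0 r\<^sub>0) < \<infinity>)"

definition doubling_constant :: "('a \<Rightarrow> 'a \<Rightarrow> real) \<Rightarrow> ('a set \<Rightarrow> ennreal) \<Rightarrow> ennreal" where
  "doubling_constant d \<mu> =
     (SUP x. SUP r\<in>{0<..}. \<mu> (Metric_space.mball UNIV d x (2 * r)) / \<mu> (Metric_space.mball UNIV d x r))"

definition least_doubling_constant :: "('a \<Rightarrow> 'a \<Rightarrow> real) \<Rightarrow> ennreal" where
  "least_doubling_constant d = (INF \<mu>\<in>{\<mu>. doubling_measure d \<mu>}. doubling_constant d \<mu>)"

definition DM :: "('a \<Rightarrow> 'a \<Rightarrow> real) \<Rightarrow> ('a set \<Rightarrow> ennreal) set" where
  "DM d = {\<mu>. doubling_measure d \<mu> \<and> doubling_constant d \<mu> = least_doubling_constant d}"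

definition induced_dist :: "('a::real_vector \<Rightarrow> real) \<Rightarrow> 'a \<Rightarrow> 'a \<Rightarrow> real" where
  "induced_dist N x y = N (x - y)"

fun norm_1 :: "real \<times> real \<Rightarrow> real" where
  "norm_1 (x, y) = \<bar>x\<bar> + \<bar>y\<bar>"

fun norm_inf :: "real \<times> real \<Rightarrow> real" where
  "norm_inf (x, y) = max \<bar>x\<bar> \<bar>y\<bar>"

lemma Metric_space_norm_1: "Metric_space UNIV (induced_dist norm_1)"
  by unfold_locales (auto simp: induced_dist_def zero_prod_def)

lemma Metric_space_norm_inf: "Metric_space UNIV (induced_dist norm_inf)"
  by unfold_locales (auto simp: induced_dist_def zero_prod_def max_def split: if_splits)

abbreviation lebesgue_outer :: "(real \<times> real) set \<Rightarrow> ennreal" where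
  "lebesgue_outer \<equiv> outer_measure_of lebesgue"

end

theory Submission
  imports Defs "HOL-Probability.Probability_Measure"
begin

text \<open>
Both norms are invariant under the quarter turn of the plane, and the description of the
minimizers holds for every such norm N. The core is a rigidity statement: a doubling measure
\<mu> with constant at most 4 is a multiple of Lebesgue measure. As the multiples of Lebesgue
measure have doubling constant exactly 4, rigidity also yields the lower bound: a measure with
constant below 4 would be a multiple of Lebesgue measure and so have constant 4. Hence the
least doubling constant is 4, and the minimizers are the multiples of Lebesgue measure.

For rigidity, the bound 4 matters because an N-ball of radius 2r has 4 times the area of one of
radius r: it says that the mean density of \<mu> over a ball does not increase when the radius
is doubled. Convolving \<mu> with a nonnegative continuous kernel \<phi> of bounded support turns this into
a statement about the continuous function u(x) = \<integral> \<phi>(x - y) d\<mu>(y): its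
average over a ball around x does not increase when the radius is doubled, while the averages
over the balls of radius r / 2^k tend to u(x). So every average of u over an N-ball is at most
its value at the centre (\<open>mollified_supermean\<close>).

A nonnegative continuous function on the plane with this property is constant
(\<open>supermean_nonneg_imp_constant\<close>), as for nonnegative superharmonic functions.
This is a feature of dimension two: it rests on a barrier that grows to infinity like a
logarithm and is strictly superharmonic far from the origin. Averages over N-balls need
not be rotation invariant, but they are invariant under the quarter turn, so it suffices to compare the
barrier at p with its values at the four points p + h, p + Jh, p - h, p - Jh, where J is the
quarter turn; there the comparison is the arithmetic-geometric mean inequality
(\<open>log_barrier_strict_supermean\<close>).

Thus every convolution of \<mu> with a kernel \<phi> is constant. Letting \<phi> increase to the
indicator of a bounded open set shows that \<mu> is translation invariant on such sets, and
Fubini identifies \<mu> with a multiple of Lebesgue measure on Borel sets. Borel regularity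
carries the identity over to all sets.
\<close>


section \<open>The quarter turn of the plane\<close>

definition quarter_turn :: "real \<times> real \<Rightarrow> real \<times> real" where
  "quarter_turn z = (- snd z, fst z)"

lemma continuous_quarter_turn [continuous_intros]:
  "continuous_on S f \<Longrightarrow> continuous_on S (\<lambda>x. quarter_turn (f x))"
  unfolding quarter_turn_def by (intro continuous_intros)

lemma measurable_quarter_turn [measurable]: "quarter_turn \<in> borel_measurable borel"
  by (intro borel_measurable_continuous_onI continuous_intros)

text \<open>
The preimage of a box under the quarter turn is a box with the two side lengths exchanged.
\<close>

lemma lborel_distr_quarter_turn: "distr lborel borel quarter_turn = lborel"
proof (rule lborel_eqI[symmetric])
  fix l u :: "real \<times> real"
  assume le: "\<And>b. b \<in> Basis \<Longrightarrow> l \<bullet> b \<le> u \<bullet> b"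
  have le1: "fst l \<le> fst u" and le2: "snd l \<le> snd u"
    using le[of "(1,0)"] le[of "(0,1)"] by (auto simp: Basis_prod_def inner_prod_def)
  have "quarter_turn -` box l u = box (snd l, - fst u) (snd u, - fst l)"
    by (auto simp: quarter_turn_def box_def Basis_prod_def inner_prod_def)
  moreover have "emeasure (lborel :: (real \<times> real) measure) (box (snd l, - fst u) (snd u, - fst l))
      = ennreal ((fst u - fst l) * (snd u - snd l))"
    using le1 le2 by (subst emeasure_lborel_box) (auto simp: Basis_prod_def prod.union_disjoint mult_ac)
  ultimately show "emeasure (distr lborel borel quarter_turn) (box l u) = (\<Prod>b\<in>Basis. (u - l) \<bullet> b)"
    using le1 le2 by (simp add: emeasure_distr Basis_prod_def prod.union_disjoint inner_prod_def mult.commute)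
qed simp


section \<open>Nonnegative supermean functions on the plane are constant\<close>

text \<open>
The function ln |z| is harmonic away from 0. Subtracting 1 inside, ln (|z|^2 - 1), makes it
strictly superharmonic while keeping its growth to infinity. The maximum with 1 extends it to
a continuous nonnegative function on the whole plane and changes it only where |z|^2 < 2.
\<close>

definition log_barrier :: "real \<times> real \<Rightarrow> real" where
  "log_barrier z = ln (max 1 ((norm z)\<^sup>2 - 1))"

lemma log_barrier_nonneg: "0 \<le> log_barrier z"
  by (simp add: log_barrier_def)

lemma continuous_log_barrier: "continuous_on S log_barrier"
  unfolding log_barrier_def by (intro continuous_intros) auto

lemma log_barrier_at_infinity: "\<exists>R. \<forall>z. R < norm z \<longrightarrow> c < log_barrier z"
proof (intro exI allI impI)
  fix z :: "real \<times> real" assume z: "exp c + 1 < norm z"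
  have "exp c + 1 < (norm z)\<^sup>2"
    using z by (smt (verit) exp_gt_zero self_le_power zero_less_numeral)
  then have "exp c < max 1 ((norm z)\<^sup>2 - 1)" by simp
  then show "c < log_barrier z"
    unfolding log_barrier_def by (metis exp_gt_zero exp_less_cancel_iff exp_ln less_trans)
qed

text \<open>
Put Q = |p|^2 - 1 and H = |h|^2. The exponentials of the four barrier values are
Q + H \<plusminus> 2s and Q + H \<plusminus> 2t, where s and t are the inner products of p with
h and with the quarter turn of h, so that s^2 + t^2 = (Q + 1) H. By the arithmetic-geometric mean
inequality for the products X and Y of the two opposite pairs, their product is at most
(Q^2 + H^2 - 2H)^2, which is less than Q^4 because H < 2. The bound |p| > 3 keeps all four
points in the region where the barrier equals ln (|z|^2 - 1).
\<close>

lemma log_barrier_strict_supermean: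
  assumes p: "3 < norm p" and h: "h \<noteq> 0" "norm h < 1"
  shows "log_barrier (p + h) + log_barrier (p + quarter_turn h) + log_barrier (p - h) +
    log_barrier (p - quarter_turn h) < 4 * log_barrier p"
proof -
  obtain a b where pab: "p = (a, b)" by force
  obtain c d where hcd: "h = (c, d)" by force
  define Q where "Q = (norm p)\<^sup>2 - 1"
  define H where "H = (norm h)\<^sup>2"
  define s where "s = a * c + b * d"
  define t where "t = b * c - a * d"
  have Q8: "Q > 8" using power_strict_mono[OF p, of 2] by (simp add: Q_def)
  have H0: "H > 0" "H < 1" using h by (auto simp: H_def power_less_one_iff abs_square_less_1)
  have st: "s\<^sup>2 + t\<^sup>2 = (Q + 1) * H"
    by (simp add: s_def t_def Q_def H_def pab hcd norm_Pair power2_eq_square algebra_simps)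
  have big: "log_barrier (p + k) = ln ((norm (p + k))\<^sup>2 - 1)" "(norm (p + k))\<^sup>2 - 1 > 0"
    if "norm k < 1" for k
  proof -
    have "norm (p + k) > 2" using norm_triangle_ineq2[of p "-k"] p that by simp
    then have "(norm (p + k))\<^sup>2 > 2\<^sup>2" by (intro power_strict_mono) auto
    then show "log_barrier (p + k) = ln ((norm (p + k))\<^sup>2 - 1)" "(norm (p + k))\<^sup>2 - 1 > 0"
      by (auto simp: log_barrier_def max_def)
  qed
  have nk: "norm (-h) < 1" "norm (quarter_turn h) < 1" "norm (- quarter_turn h) < 1" 
    using h by (auto simp: quarter_turn_def hcd norm_Pair algebra_simps)
  have norm_sq: "(norm (x, y))\<^sup>2 = x\<^sup>2 + y\<^sup>2" for x y :: real
    by (simp add: norm_Pair)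
  have e: "(norm (p + h))\<^sup>2 - 1 = Q + H + 2 * s" "(norm (p + (- h)))\<^sup>2 - 1 = Q + H - 2 * s"
    "(norm (p + quarter_turn h))\<^sup>2 - 1 = Q + H + 2 * t"
    "(norm (p + (- quarter_turn h)))\<^sup>2 - 1 = Q + H - 2 * t"
    unfolding s_def t_def Q_def H_def pab hcd quarter_turn_def
    by (simp_all add: norm_sq) (simp_all add: power2_eq_square algebra_simps)
  note pos = big(2)[OF h(2)] big(2)[OF nk(1)] big(2)[OF nk(2)] big(2)[OF nk(3)]
  define X where "X = (Q + H + 2 * s) * (Q + H - 2 * s)"
  define Y where "Y = (Q + H + 2 * t) * (Q + H - 2 * t)"
  have XY0: "X > 0" "Y > 0" using pos unfolding e X_def Y_def by auto
  have sum: "X + Y = 2 * (Q\<^sup>2 + H\<^sup>2 - 2 * H)"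
    using st by (simp add: X_def Y_def power2_eq_square algebra_simps)
  have "X * Y \<le> (Q\<^sup>2 + H\<^sup>2 - 2 * H)\<^sup>2"
    using sum_squares_ge_zero[of "X - Y" 0] arg_cong[OF sum, of "\<lambda>x. x\<^sup>2"]
    by (simp add: power2_eq_square algebra_simps)
  also have "\<dots> < (Q\<^sup>2)\<^sup>2"
  proof (rule power_strict_mono)
    have "H * H < H * 2" using H0 by (intro mult_strict_left_mono) auto
    then show "Q\<^sup>2 + H\<^sup>2 - 2 * H < Q\<^sup>2" by (simp add: power2_eq_square)
    show "0 \<le> Q\<^sup>2 + H\<^sup>2 - 2 * H" using add_pos_pos[OF XY0] unfolding sum by simp
  qed simp
  finally have "ln (X * Y) < ln (Q ^ 4)" 
    using mult_pos_pos[OF XY0] Q8 by (simp flip: power_mult)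
  moreover have "log_barrier p = ln Q" using Q8 by (auto simp: log_barrier_def Q_def max_def)
  moreover have "ln (X * Y) = log_barrier (p + h) + log_barrier (p + quarter_turn h) + log_barrier (p - h) +
    log_barrier (p - quarter_turn h)"
    using pos big(1)[OF h(2)] big(1)[OF nk(1)] big(1)[OF nk(2)] big(1)[OF nk(3)]
    unfolding e X_def Y_def by (simp add: ln_mult)
  ultimately show ?thesis using Q8 by (simp add: ln_realpow)
qed

lemma integrable_continuous_bounded_support:
  fixes f :: "'a::euclidean_space \<Rightarrow> real"
  assumes "finite_measure M" and sets_M: "sets M = sets borel" and bounded: "AE h in M. norm h \<le> R"
    and cont: "continuous_on UNIV f"
  shows "integrable M f"
proof -
  have "bounded (f ` cball 0 R)"
    by (intro compact_imp_bounded compact_continuous_image continuous_on_subset[OF cont]) auto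
  then obtain C where C: "\<forall>y\<in>f ` cball 0 R. norm y \<le> C"
    unfolding bounded_iff by blast
  have "AE h in M. norm (f h) \<le> C"
    using bounded by (rule eventually_mono) (use C in simp)
  moreover have "f \<in> borel_measurable M"
    using borel_measurable_continuous_onI[OF cont] by (simp add: measurable_cong_sets[OF sets_M])
  ultimately show ?thesis by (rule finite_measure.integrable_const_bound[OF \<open>finite_measure M\<close>])
qed

text \<open>
The measure P is the averaging distribution; the average of u over x + t h may be taken at every
scale t. For small e > 0 the function u + e * \<open>log_barrier\<close> tends to infinity and so
has a global minimum point. This point cannot lie at distance more than 3 from the origin: there
the barrier has strict supermeans over quarter-turn orbits and u has supermeans, against
minimality. Letting e tend to 0, the minimum of u over the disc of radius 3 is a global
minimum of u, attained at q say. As the average of u around q at any scale is at most u(q), u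
equals u(q) on arbitrarily large discs around q. Invariance of P under the quarter turn lets
averages of u be rewritten as averages over quarter-turn orbits.
\<close>

theorem supermean_nonneg_imp_constant:
  fixes u :: "real \<times> real \<Rightarrow> real" and P :: "(real \<times> real) measure"
  assumes P: "prob_space P" and sets_P: "sets P = sets borel"
    and turn: "distr P borel quarter_turn = P"
    and bounded: "AE h in P. norm h \<le> R"
    and charged: "\<And>U. open U \<Longrightarrow> U \<noteq> {} \<Longrightarrow> U \<subseteq> ball 0 \<rho> \<Longrightarrow> emeasure P U \<noteq> 0" and "\<rho> > 0"
    and cont: "continuous_on UNIV u" and nonneg: "\<And>x. 0 \<le> u x"
    and supermean: "\<And>x t. t > 0 \<Longrightarrow> (\<integral>h. u (x + t *\<^sub>R h) \<partial>P) \<le> u x"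
  shows "u x = u y"
proof -
  interpret prob_space P by fact
  have [measurable_cong]: "sets P = sets borel" by fact
  have int: "integrable P f" if f: "continuous_on UNIV f" for f :: "real \<times> real \<Rightarrow> real"
    by (rule integrable_continuous_bounded_support[OF finite_measure_axioms sets_P bounded f])
  have cont_aff: "continuous_on UNIV (\<lambda>h. u (x + t *\<^sub>R h))" for x and t :: real
    by (intro continuous_on_compose2[OF cont] continuous_intros) auto
  have turn_int: "(\<integral>h. f h \<partial>P) = (\<integral>h. f (quarter_turn h) \<partial>P)"
    if "continuous_on UNIV f" for f :: "real \<times> real \<Rightarrow> real"
    by (subst turn[symmetric], subst integral_distr)
       (use borel_measurable_continuous_onI[OF that] in \<open>auto simp: sets_P cong: measurable_cong_sets\<close>)
  have turn2: "quarter_turn (quarter_turn h) = - h" for h by (simp add: quarter_turn_def prod_eq_iff)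
  have turn_neg: "quarter_turn (- h) = - quarter_turn h" for h by (simp add: quarter_turn_def)

  have zero_on_ball: "\<exists>h. h \<in> U \<and> f h = 0"
    if "continuous_on UNIV f" "\<And>h. norm h \<le> R \<Longrightarrow> 0 \<le> f h" "(\<integral>h. f h \<partial>P) \<le> 0" "open U" "U \<noteq> {}" "U \<subseteq> ball 0 \<rho>" 
    for f :: "real \<times> real \<Rightarrow> real" and U
  proof (rule ccontr)
    assume neg: "\<not> ?thesis"
    have f0: "AE h in P. 0 \<le> f h" using bounded by (rule eventually_mono) (rule that(2))
    then have "(\<integral>h. f h \<partial>P) = 0" using that(3) by (intro antisym integral_nonneg_AE) auto
    then have "AE h in P. f h = 0"
      using f0 int[OF that(1)] by (subst (asm) integral_nonneg_eq_0_iff_AE) auto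
    then have "AE h in P. h \<notin> U" by (rule eventually_mono) (use neg in auto)
    then have "emeasure P U = 0"
      using that(4) by (subst (asm) AE_iff_measurable[of U]) (auto simp: sets_P sets_eq_imp_space_eq[OF sets_P])
    with charged[OF that(4-6)] show False by simp
  qed

  have "\<exists>q\<in>cball 0 3. \<forall>x\<in>cball 0 3. u q \<le> u x"
    by (intro continuous_attains_inf continuous_on_subset[OF cont]) (auto simp del: split_paired_Ex)
  then obtain q where q: "q \<in> cball 0 3" "\<And>x. x \<in> cball 0 3 \<Longrightarrow> u q \<le> u x" by blast
  have approx: "u q \<le> u x + e * log_barrier x" if e: "e > 0" for x e
  proof -
    define w where "w z = u z + e * log_barrier z" for z
    obtain S where S: "\<And>z. S < norm z \<Longrightarrow> w 0 / e < log_barrier z"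
      using log_barrier_at_infinity by metis
    have "continuous_on (cball 0 (max S 0)) w" unfolding w_def
      by (intro continuous_intros continuous_on_subset[OF cont] continuous_log_barrier) auto
    then have "\<exists>p\<in>cball 0 (max S 0). \<forall>z\<in>cball 0 (max S 0). w p \<le> w z"
      by (intro continuous_attains_inf) (auto simp del: split_paired_Ex)
    then obtain p where p: "p \<in> cball 0 (max S 0)" "\<And>z. z \<in> cball 0 (max S 0) \<Longrightarrow> w p \<le> w z"
      by blast
    have pmin: "w p \<le> w z" for z
    proof (cases "norm z \<le> max S 0")
      case False
      then have "w 0 \<le> e * log_barrier z" using S[of z] e by (simp add: field_simps not_le)
      also have "\<dots> \<le> w z" using nonneg[of z] by (simp add: w_def)
      finally show ?thesis using p(2)[of 0] by simp
    qed (use p in auto)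
    have "norm p \<le> 3"
    proof (rule ccontr)
      assume far: "\<not> norm p \<le> 3"
      \<comment> \<open>A scale so small that P-almost all increments t h have norm below 1, as the barrier
        comparison demands, and so do all those with h in the disc of radius \<open>\<rho>\<close>.\<close>
      define t where "t = 1 / (max R \<rho> + 1)"
      have tR: "norm (t *\<^sub>R h) < 1" if "norm h \<le> max R \<rho>" for h :: "real \<times> real"
        using that \<open>\<rho> > 0\<close> by (auto simp: t_def field_simps)
      have t0: "t > 0" using \<open>\<rho> > 0\<close> by (auto simp: t_def field_simps)
      \<comment> \<open>By minimality of p this orbit difference of u is at least -e times that of the barrier,
        hence positive for small h other than 0; but its integral is at most 0.\<close>
      define f where "f h = u (p + t *\<^sub>R h) + u (p + t *\<^sub>R quarter_turn h)
        + u (p + t *\<^sub>R (- h)) + u (p + t *\<^sub>R quarter_turn (- h)) - 4 * u p" for h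
      have f_pos: "0 < f h" if h: "h \<noteq> 0" "norm h \<le> max R \<rho>" for h
      proof -
        have "log_barrier (p + t *\<^sub>R h) + log_barrier (p + quarter_turn (t *\<^sub>R h)) + log_barrier (p - t *\<^sub>R h)
          + log_barrier (p - quarter_turn (t *\<^sub>R h)) < 4 * log_barrier p"
          using far tR[OF h(2)] h(1) t0 by (intro log_barrier_strict_supermean) auto
        moreover have "quarter_turn (t *\<^sub>R h) = t *\<^sub>R quarter_turn h" by (simp add: quarter_turn_def)
        ultimately have "e * (log_barrier (p + t *\<^sub>R h) + log_barrier (p + t *\<^sub>R quarter_turn h)
          + log_barrier (p + t *\<^sub>R (- h)) + log_barrier (p + t *\<^sub>R quarter_turn (- h)))
          < e * (4 * log_barrier p)"
          using e by (intro mult_strict_left_mono) (auto simp: turn_neg)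
        then show ?thesis
          using pmin[of "p + t *\<^sub>R h"] pmin[of "p + t *\<^sub>R quarter_turn h"]
            pmin[of "p + t *\<^sub>R (- h)"] pmin[of "p + t *\<^sub>R quarter_turn (- h)"]
          unfolding f_def w_def by (simp add: algebra_simps)
      qed
      have f_zero: "f 0 = 0" by (simp add: f_def quarter_turn_def flip: zero_prod_def)
      have four: "continuous_on UNIV (\<lambda>h. u (p + t *\<^sub>R h))"
        "continuous_on UNIV (\<lambda>h. u (p + t *\<^sub>R quarter_turn h))"
        "continuous_on UNIV (\<lambda>h. u (p + t *\<^sub>R (- h)))"
        "continuous_on UNIV (\<lambda>h. u (p + t *\<^sub>R quarter_turn (- h)))"
        by (intro continuous_on_compose2[OF cont] continuous_intros subset_UNIV)+
      have "(\<integral>h. f h \<partial>P) = 4 * (\<integral>h. u (p + t *\<^sub>R h) \<partial>P) - 4 * u p"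
        using int[OF four(1)] int[OF four(2)] int[OF four(3)] int[OF four(4)]
          turn_int[OF four(1)] turn_int[OF four(2)] turn_int[OF four(3)] 
        unfolding f_def by (simp add: turn2 turn_neg prob_space)
      then have "(\<integral>h. f h \<partial>P) \<le> 0" using supermean[OF t0, of p] by simp
      moreover have "continuous_on UNIV f" unfolding f_def by (intro continuous_intros four)
      moreover have "ball 0 \<rho> - {0 :: real \<times> real} \<noteq> {}"
      proof -
        have "(\<rho> / 2, 0) \<in> ball 0 \<rho> - {0 :: real \<times> real}"
          using \<open>\<rho> > 0\<close> by (simp add: dist_Pair_Pair zero_prod_def)
        then show ?thesis by blast
      qed
      moreover have "0 \<le> f h" if "norm h \<le> R" for h
        using f_pos[of h] f_zero that by (cases "h = 0") (auto simp: le_max_iff_disj less_imp_le)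
      ultimately obtain h where "h \<in> ball 0 \<rho> - {0}" "f h = 0"
        using zero_on_ball[of f "ball 0 \<rho> - {0}"] by (auto simp: open_delete)
      then show False using f_pos[of h] by (auto simp: le_max_iff_disj)
    qed
    then have "u q \<le> u p" using q by auto
    also have "\<dots> \<le> w p" using e log_barrier_nonneg[of p] by (simp add: w_def)
    finally show ?thesis using pmin[of x] by (simp add: w_def)
  qed
  have qmin: "u q \<le> u x" for x
  proof (rule field_le_epsilon)
    fix e :: real assume "e > 0"
    then show "u q \<le> u x + e"
      using approx[of "e / (log_barrier x + 1)" x] log_barrier_nonneg[of x]
      by (smt (verit) divide_nonneg_pos divide_pos_pos mult_imp_div_pos_le mult_less_cancel_left_pos times_divide_eq_left)
  qed
  have "u x = u q" for x
  proof -
    \<comment> \<open>A scale so large that x lies in the disc of radius \<open>t * \<rho>\<close> around q.\<close>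
    define t where "t = (norm (x - q) + 1) / \<rho>"
    have t: "t > 0" using \<open>\<rho> > 0\<close> by (simp add: t_def add_nonneg_pos)
    define U where "U = ball 0 \<rho> \<inter> {h. u (q + t *\<^sub>R h) \<noteq> u q}"
    have "open U" unfolding U_def
      by (intro open_Int open_ball open_Collect_neq cont_aff continuous_intros)
    moreover have "(\<integral>h. u (q + t *\<^sub>R h) - u q \<partial>P) \<le> 0"
      using supermean[OF t, of q] int[OF cont_aff] by (simp add: prob_space)
    moreover have "continuous_on UNIV (\<lambda>h. u (q + t *\<^sub>R h) - u q)"
      by (intro continuous_intros cont_aff)
    ultimately have "\<exists>h. h \<in> U \<and> u (q + t *\<^sub>R h) - u q = 0" if "U \<noteq> {}"
      using that qmin by (intro zero_on_ball) (simp_all add: U_def)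
    then have "U = {}" unfolding U_def by force
    moreover have "(1 / t) *\<^sub>R (x - q) \<in> ball 0 \<rho>"
    proof -
      have "norm ((1 / t) *\<^sub>R (x - q)) = norm (x - q) / t" using t by (simp del: scaleR_diff_right)
      also have "\<dots> < \<rho>"
        using t \<open>\<rho> > 0\<close> by (simp add: pos_divide_less_eq) (simp add: t_def)
      finally show ?thesis by simp
    qed
    ultimately have "u (q + t *\<^sub>R ((1 / t) *\<^sub>R (x - q))) = u q" unfolding U_def by blast
    then show ?thesis using t by simp
  qed
  then show ?thesis by metis
qed


section \<open>Convolution and translation invariance\<close>

lemma nn_integral_lborel_translate:
  fixes c :: "'a::euclidean_space"
  assumes [measurable]: "g \<in> borel_measurable borel"
  shows "(\<integral>\<^sup>+h. g (c + h) \<partial>lborel) = (\<integral>\<^sup>+h. g h \<partial>lborel)"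
  by (subst (2) lborel_distr_plus[symmetric, of c]) (simp add: nn_integral_distr)

text \<open>
Fubini together with the substitution h = z + y - x. With g the indicator of a ball around 0,
it expresses ball averages of a convolution through the M-measures of balls; with k and g both
indicators, it compares M with Lebesgue measure.
\<close>

lemma nn_integral_convolution_swap:
  fixes M :: "'a::euclidean_space measure"
  assumes "sigma_finite_measure M" and sets_M: "sets M = sets borel"
    and [measurable]: "k \<in> borel_measurable borel" "g \<in> borel_measurable borel"
  shows "(\<integral>\<^sup>+h. (\<integral>\<^sup>+y. k (x + h - y) \<partial>M) * g h \<partial>lborel)
    = (\<integral>\<^sup>+z. k z * (\<integral>\<^sup>+y. g (z + y - x) \<partial>M) \<partial>lborel)"
proof -
  interpret M: sigma_finite_measure M by fact
  interpret pair_sigma_finite M lborel ..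
  note [measurable_cong] = sets_M
  have "(\<integral>\<^sup>+h. (\<integral>\<^sup>+y. k (x + h - y) \<partial>M) * g h \<partial>lborel)
      = (\<integral>\<^sup>+h. (\<integral>\<^sup>+y. k (x + h - y) * g h \<partial>M) \<partial>lborel)"
    by (simp add: nn_integral_multc)
  also have "\<dots> = (\<integral>\<^sup>+y. (\<integral>\<^sup>+h. k (x + h - y) * g h \<partial>lborel) \<partial>M)"
    by (rule Fubini') measurable
  also have "\<dots> = (\<integral>\<^sup>+y. (\<integral>\<^sup>+z. k z * g (z + y - x) \<partial>lborel) \<partial>M)"
  proof (rule nn_integral_cong)
    fix y
    show "(\<integral>\<^sup>+h. k (x + h - y) * g h \<partial>lborel) = (\<integral>\<^sup>+z. k z * g (z + y - x) \<partial>lborel)"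
      by (subst nn_integral_lborel_translate[symmetric, where c = "y - x"]) (simp_all add: algebra_simps)
  qed
  also have "\<dots> = (\<integral>\<^sup>+z. (\<integral>\<^sup>+y. k z * g (z + y - x) \<partial>M) \<partial>lborel)"
    by (rule Fubini'[symmetric]) measurable
  also have "\<dots> = (\<integral>\<^sup>+z. k z * (\<integral>\<^sup>+y. g (z + y - x) \<partial>M) \<partial>lborel)"
    by (intro nn_integral_cong nn_integral_cmult) measurable
  finally show ?thesis .
qed

lemma nn_integral_lborel_scale:
  fixes c :: real
  assumes [measurable]: "g \<in> borel_measurable borel" and "c \<noteq> 0"
  shows "(\<integral>\<^sup>+h. g h \<partial>lborel) = ennreal (\<bar>c\<bar> ^ DIM('a)) * (\<integral>\<^sup>+h. g (c *\<^sub>R (h :: 'a::euclidean_space)) \<partial>lborel)"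
  by (subst lborel_affine[OF \<open>c \<noteq> 0\<close>, of 0])
     (simp add: nn_integral_density nn_integral_distr nn_integral_cmult)

lemma sigma_finite_if_finite_on_balls:
  fixes M :: "'a::euclidean_space measure"
  assumes sets_M: "sets M = sets borel" and finite: "\<And>n. emeasure M (ball 0 (real n)) < \<infinity>"
  shows "sigma_finite_measure M"
proof
  let ?A = "range (\<lambda>n. ball (0::'a) (real n))"
  have "(\<Union>n. ball (0::'a) (real n)) = UNIV"
    using reals_Archimedean2 by auto
  then show "\<exists>A. countable A \<and> A \<subseteq> sets M \<and> \<Union> A = space M \<and> (\<forall>a\<in>A. emeasure M a \<noteq> \<infinity>)"
    using finite by (intro exI[of _ ?A]) (auto simp: sets_M sets_eq_imp_space_eq[OF sets_M] less_top)
qed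

text \<open>
Integrating M(x - U) over x in V in two ways gives M(-U) \<lambda>(V) = \<lambda>(U) M(V). With U the
unit cube, this says that M is a multiple of Lebesgue measure on bounded open sets, which include
the generating boxes.
\<close>

lemma translation_invariant_imp_lborel:
  fixes M :: "'a::euclidean_space measure"
  assumes sets_M: "sets M = sets borel"
    and finite: "\<And>U. open U \<Longrightarrow> bounded U \<Longrightarrow> emeasure M U < \<infinity>"
    and invariant: "\<And>U x. open U \<Longrightarrow> bounded U \<Longrightarrow> emeasure M {y. x - y \<in> U} = emeasure M {y. - y \<in> U}"
    and nontrivial: "open W" "bounded W" "emeasure M W \<noteq> 0"
  shows "\<exists>\<alpha>>0. \<forall>A\<in>sets borel. emeasure M A = ennreal \<alpha> * emeasure lborel A"
proof -
  have M: "sigma_finite_measure M"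
    by (intro sigma_finite_if_finite_on_balls sets_M finite) auto
  note [measurable_cong] = sets_M
  have nn_ind: "(\<integral>\<^sup>+y. indicator U (f y) \<partial>M) = emeasure M {y. f y \<in> U}"
    if "open U" "continuous_on UNIV f" for U and f :: "'a \<Rightarrow> 'a"
  proof -
    have "open {y. f y \<in> U}" using open_vimage[OF that] by (simp add: vimage_def)
    then have "emeasure M {y. f y \<in> U} = (\<integral>\<^sup>+y. indicator {y. f y \<in> U} y \<partial>M)"
      by (subst nn_integral_indicator) (auto simp: sets_M)
    then show ?thesis by (simp add: indicator_def)
  qed
  have product: "emeasure M {y. - y \<in> U} * emeasure lborel V = emeasure lborel U * emeasure M V"
    if U: "open U" "bounded U" and V: "open V" "bounded V" for U V
  proof -
    have [measurable]: "U \<in> sets borel" "V \<in> sets borel" using U V by auto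
    have uV: "open (uminus ` V)" "bounded (uminus ` V)" 
      using V open_negations[of V] by (auto simp: bounded_uminus)
    have mem: "- y \<in> uminus ` V \<longleftrightarrow> y \<in> V" for y by auto
    have "{y. z + y \<in> V} = {y. (- z) - y \<in> uminus ` V}" for z
      using mem[of "z + _"] by (auto simp: image_iff)
    then have inv_V: "emeasure M {y. z + y \<in> V} = emeasure M V" for z
      using invariant[OF uV, of "-z"] by (simp add: mem)
    have "emeasure M {y. - y \<in> U} * emeasure lborel V
        = (\<integral>\<^sup>+h. (\<integral>\<^sup>+y. indicator U (0 + h - y) \<partial>M) * indicator V h \<partial>lborel)"
      by (subst nn_ind) (auto simp: nn_integral_cmult_indicator invariant[OF U] U intro!: continuous_intros)
    also have "\<dots> = (\<integral>\<^sup>+z. indicator U z * (\<integral>\<^sup>+y. indicator V (z + y - 0) \<partial>M) \<partial>lborel)"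
      by (rule nn_integral_convolution_swap[OF M sets_M]) auto
    also have "\<dots> = emeasure lborel U * emeasure M V"
      by (subst nn_ind) (auto simp: inv_V nn_integral_multc V intro!: continuous_intros)
    finally show ?thesis .
  qed
  define Q where "Q = box (0::'a) One"
  have Q: "open Q" "bounded Q" "emeasure lborel Q = 1"
    by (auto simp: Q_def bounded_box emeasure_lborel_box)
  have nQ: "open {y. - y \<in> Q}" "bounded {y. - y \<in> Q}"
  proof -
    have "{y. - y \<in> Q} = uminus ` Q" by force
    then show "open {y. - y \<in> Q}" "bounded {y. - y \<in> Q}"
      using Q open_negations[of Q] by (auto simp: bounded_uminus)
  qed
  define \<alpha> where "\<alpha> = emeasure M {y. - y \<in> Q}"
  have on_open: "emeasure M V = \<alpha> * emeasure lborel V" if "open V" "bounded V" for V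
    using product[OF Q(1,2) that] by (simp add: Q \<alpha>_def)
  have "\<alpha> \<noteq> 0" using on_open[OF nontrivial(1,2)] nontrivial(3) by auto
  have "\<alpha> < \<infinity>" unfolding \<alpha>_def by (rule finite[OF nQ])
  have "lborel = scale_measure (1 / \<alpha>) M"
  proof (rule lborel_eqI)
    fix l u :: 'a assume "\<And>b. b \<in> Basis \<Longrightarrow> l \<bullet> b \<le> u \<bullet> b"
    then have "emeasure M (box l u) = ennreal (\<Prod>b\<in>Basis. (u - l) \<bullet> b) * \<alpha>"
      using on_open[OF open_box bounded_box, of l u] by (simp add: emeasure_lborel_box mult.commute)
    then show "emeasure (scale_measure (1 / \<alpha>) M) (box l u) = (\<Prod>b\<in>Basis. (u - l) \<bullet> b)"
      using \<open>\<alpha> \<noteq> 0\<close> \<open>\<alpha> < \<infinity>\<close>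
      by (simp add: ennreal_divide_times ennreal_mult_divide_eq)
  qed (simp add: sets_M)
  then have "emeasure lborel A = (1 / \<alpha>) * emeasure M A" for A
    by (metis emeasure_scale_measure)
  then have "emeasure M A = \<alpha> * emeasure lborel A" for A
    using \<open>\<alpha> \<noteq> 0\<close> \<open>\<alpha> < \<infinity>\<close> by (simp flip: mult.assoc add: ennreal_times_divide)
  moreover obtain a where "\<alpha> = ennreal a" "a > 0"
    using \<open>\<alpha> \<noteq> 0\<close> \<open>\<alpha> < \<infinity>\<close> by (cases \<alpha>) (auto simp: less_le)
  ultimately show ?thesis by blast
qed


section \<open>Norms on the plane invariant under the quarter turn\<close>

locale quarter_turn_norm =
  fixes N :: "real \<times> real \<Rightarrow> real"
  assumes N_triangle: "N (x + y) \<le> N x + N y"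
    and N_scaleR: "N (c *\<^sub>R x) = \<bar>c\<bar> * N x"
    and N_eq_0D: "N x = 0 \<Longrightarrow> x = 0"
    and N_turn: "N (quarter_turn x) = N x"
begin

lemma N_zero [simp]: "N 0 = 0"
  using N_scaleR[of 0 0] by simp

lemma N_uminus [simp]: "N (- x) = N x"
  using N_scaleR[of "-1" x] by simp

lemma N_nonneg [simp]: "0 \<le> N x"
  using N_triangle[of x "- x"] by simp

lemma N_minus_commute: "N (x - y) = N (y - x)"
  using N_uminus[of "x - y"] by simp

text \<open>
All norms on the plane are equivalent; this and the opposite estimate \<open>N_lower\<close> make
the topology, the Borel sets and the bounded sets of N those of the Euclidean plane.
\<close>

lemma N_upper: obtains K where "K > 0" "\<And>x. N x \<le> K * norm x"
proof
  show "N (1, 0) + N (0, 1) + 1 > 0"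
    by (intro add_nonneg_pos add_nonneg_nonneg) auto
  fix x :: "real \<times> real"
  have "x = fst x *\<^sub>R (1, 0) + snd x *\<^sub>R (0, 1)" by (simp add: prod_eq_iff)
  then have "N x \<le> \<bar>fst x\<bar> * N (1, 0) + \<bar>snd x\<bar> * N (0, 1)"
    by (metis N_scaleR N_triangle)
  also have "\<dots> \<le> norm x * N (1, 0) + norm x * N (0, 1)"
    using norm_fst_le[of "fst x" "snd x"] norm_snd_le[of "snd x" "fst x"]
    by (intro add_mono mult_right_mono) auto
  also have "\<dots> \<le> (N (1, 0) + N (0, 1) + 1) * norm x" by (simp add: algebra_simps)
  finally show "N x \<le> (N (1, 0) + N (0, 1) + 1) * norm x" .
qed

lemma continuous_on_N [continuous_intros]:
  assumes "continuous_on S f"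
  shows "continuous_on S (\<lambda>x. N (f x))"
proof -
  obtain K where K: "K > 0" "\<And>x. N x \<le> K * norm x" using N_upper by blast
  have "\<bar>N x - N y\<bar> \<le> K * norm (x - y)" for x y
    using N_triangle[of "x - y" y] N_triangle[of "y - x" x] N_minus_commute[of x y] K(2)[of "x - y"]
    by (auto simp: algebra_simps)
  then have "K-lipschitz_on UNIV N"
    using K(1) by (intro lipschitz_onI) (auto simp: dist_norm)
  then have "continuous_on UNIV N" by (rule lipschitz_on_continuous_on)
  then show ?thesis by (rule continuous_on_compose2[OF _ assms]) auto
qed

text \<open>
The constant is the minimum of N on the unit circle.
\<close>

lemma N_lower: obtains c where "c > 0" "\<And>x. c * norm x \<le> N x"
proof -
  have "\<exists>p\<in>sphere 0 1. \<forall>x\<in>sphere 0 1. N p \<le> N x"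
  proof (rule continuous_attains_inf)
    show "sphere (0 :: real \<times> real) 1 \<noteq> {}"
      using norm_Pair[of "1::real" "0::real"] by (metis emptyE mem_sphere_0 norm_one norm_zero real_sqrt_one power_one zero_power2 add.right_neutral)
  qed (auto intro!: continuous_intros)
  then obtain p where p: "norm p = 1" "\<And>x. norm x = 1 \<Longrightarrow> N p \<le> N x" by auto
  show ?thesis
  proof
    show "N p > 0" using N_eq_0D[of p] p(1) N_nonneg[of p] by (metis less_eq_real_def norm_zero zero_neq_one)
    fix x :: "real \<times> real"
    show "N p * norm x \<le> N x"
    proof (cases "x = 0")
      case False
      then have "N p \<le> N ((1 / norm x) *\<^sub>R x)" by (intro p) simp
      also have "\<dots> = N x / norm x" by (simp add: N_scaleR)
      finally show ?thesis using False by (simp add: field_simps)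
    qed simp
  qed
qed

definition nball :: "real \<times> real \<Rightarrow> real \<Rightarrow> (real \<times> real) set" where
  "nball x r = {y. N (x - y) < r}"

lemma open_nball [simp]: "open (nball x r)"
  unfolding nball_def by (intro open_Collect_less continuous_intros)

lemma sets_nball [measurable, simp]: "nball x r \<in> sets borel"
  by simp

lemma bounded_nball [simp]: "bounded (nball x r)"
proof -
  obtain c where c: "c > 0" "\<And>x. c * norm x \<le> N x" using N_lower by blast
  have "nball x r \<subseteq> cball x (r / c)"
  proof
    fix y assume "y \<in> nball x r"
    then have "c * norm (x - y) \<le> r" using c(2)[of "x - y"] by (simp add: nball_def)
    then show "y \<in> cball x (r / c)" using c(1) by (simp add: dist_norm field_simps)
  qed
  then show ?thesis by (rule bounded_subset[OF bounded_cball])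
qed

lemma bounded_subset_nball:
  assumes "bounded A" obtains r where "A \<subseteq> nball 0 r"
proof -
  obtain K where K: "K > 0" "\<And>x. N x \<le> K * norm x" using N_upper by blast
  obtain b where b: "\<And>x. x \<in> A \<Longrightarrow> norm x \<le> b" using assms unfolding bounded_iff by blast
  have "A \<subseteq> nball 0 (K * b + 1)"
  proof
    fix x assume "x \<in> A"
    then have "K * norm x \<le> K * b" using b K(1) by simp
    then show "x \<in> nball 0 (K * b + 1)" using K(2)[of x] by (simp add: nball_def)
  qed
  then show ?thesis by (rule that)
qed

lemma ball_subset_nball:
  assumes "r > 0" obtains s where "s > 0" "\<And>x. ball x s \<subseteq> nball x r"
proof -
  obtain K where K: "K > 0" "\<And>x. N x \<le> K * norm x" using N_upper by blast
  show ?thesis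
  proof
    show "r / K > 0" using assms K by simp
    show "ball x (r / K) \<subseteq> nball x r" for x
    proof
      fix y assume "y \<in> ball x (r / K)"
      then have "K * norm (x - y) < r" using K(1) by (simp add: dist_norm field_simps)
      then show "y \<in> nball x r" using K(2)[of "x - y"] by (simp add: nball_def)
    qed
  qed
qed

lemma Metric_space_N: "Metric_space UNIV (induced_dist N)"
proof
  fix x y z
  show "induced_dist N x z \<le> induced_dist N x y + induced_dist N y z"
    using N_triangle[of "x - y" "y - z"] by (simp add: induced_dist_def)
  show "induced_dist N x y = 0 \<longleftrightarrow> x = y"
    using N_eq_0D[of "x - y"] by (auto simp: induced_dist_def)
qed (auto simp: induced_dist_def N_minus_commute)

lemma mball_N: "Metric_space.mball UNIV (induced_dist N) x r = nball x r"
  by (auto simp: Metric_space.mball_def[OF Metric_space_N] nball_def induced_dist_def)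

lemma openin_N: "openin (Metric_space.mtopology UNIV (induced_dist N)) U \<longleftrightarrow> open U"
proof -
  have "(\<exists>r>0. nball x r \<subseteq> U) \<longleftrightarrow> (\<exists>e>0. ball x e \<subseteq> U)" for x
  proof
    assume "\<exists>r>0. nball x r \<subseteq> U"
    then obtain r where "r > 0" "nball x r \<subseteq> U" by blast
    then show "\<exists>e>0. ball x e \<subseteq> U" using ball_subset_nball[OF \<open>r > 0\<close>] by (metis subset_trans)
  next
    assume "\<exists>e>0. ball x e \<subseteq> U"
    then obtain e where e: "e > 0" "ball x e \<subseteq> U" by blast
    obtain c where c: "c > 0" "\<And>x. c * norm x \<le> N x" using N_lower by blast
    have "nball x (c * e) \<subseteq> ball x e"
    proof
      fix y assume "y \<in> nball x (c * e)"
      then have "c * norm (x - y) < c * e" using c(2)[of "x - y"] by (simp add: nball_def)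
      then show "y \<in> ball x e" using c(1) by (simp add: dist_norm)
    qed
    then show "\<exists>r>0. nball x r \<subseteq> U" using c e by (intro exI[of _ "c * e"]) auto
  qed
  then show ?thesis
    by (auto simp: Metric_space.openin_mtopology[OF Metric_space_N] mball_N open_contains_ball)
qed

lemma borel_sets_of_N: "borel_sets_of (induced_dist N) = sets borel"
  by (simp add: borel_sets_of_def openin_N borel_def)

lemma emeasure_nball_scale:
  assumes "c > 0"
  shows "emeasure lborel (nball x (c * r)) = ennreal (c\<^sup>2) * emeasure lborel (nball x r)"
proof -
  have centre: "emeasure lborel (nball x r) = (\<integral>\<^sup>+h. indicator (nball 0 r) h \<partial>lborel)" for x r
  proof -
    have "emeasure lborel (nball x r) = (\<integral>\<^sup>+h. indicator (nball x r) h \<partial>lborel)" by simp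
    also have "\<dots> = (\<integral>\<^sup>+h. indicator (nball x r) (x + h) \<partial>lborel)"
      by (rule nn_integral_lborel_translate[symmetric]) measurable
    also have "\<dots> = (\<integral>\<^sup>+h. indicator (nball 0 r) h \<partial>lborel)"
      by (simp add: nball_def indicator_def)
    finally show ?thesis .
  qed
  have "c *\<^sub>R h \<in> nball 0 (c * r) \<longleftrightarrow> h \<in> nball 0 r" for h
    using assms by (simp add: nball_def N_scaleR)
  then have "(\<lambda>h. indicator (nball 0 (c * r)) (c *\<^sub>R h) :: ennreal) = indicator (nball 0 r)"
    by (simp add: indicator_def fun_eq_iff)
  moreover have "indicator (nball 0 (c * r)) \<in> borel_measurable (borel :: (real \<times> real) measure)"
    by measurable
  ultimately show ?thesis unfolding centre
    using assms by (subst nn_integral_lborel_scale[where c = c]) (simp_all add: power2_eq_square)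
qed

lemma emeasure_nball_pos: 
  assumes "r > 0" shows "emeasure lborel (nball x r) \<noteq> 0"
proof -
  obtain s where "s > 0" "ball x s \<subseteq> nball x r" using ball_subset_nball[OF assms] by metis
  then show ?thesis
    using emeasure_mono[of "ball x s" "nball x r" lborel] open_not_negligible[of "ball x s"]
    by (auto simp: negligible_iff_emeasure0)
qed

lemma emeasure_nball_finite: "emeasure lborel (nball x r) < \<infinity>"
  by (intro emeasure_bounded_finite) simp

text \<open>
The image of this measure under h \<mapsto> x + t h is normalized area on the ball of radius t around x,
so averages over all balls become integrals with respect to one measure.
\<close>

definition ball_prob :: "(real \<times> real) measure" where
  "ball_prob = uniform_measure lborel (nball 0 1)"

lemma sets_ball_prob: "sets ball_prob = sets borel"
  by (simp add: ball_prob_def)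

lemma prob_space_ball_prob: "prob_space ball_prob"
  unfolding ball_prob_def
  using emeasure_nball_pos[of 1 0] emeasure_nball_finite[of 0 1] by (intro prob_space_uniform_measure) auto

lemma AE_ball_prob_bounded: obtains b where "AE h in ball_prob. norm h \<le> b"
proof -
  obtain b where b: "\<And>h. h \<in> nball 0 1 \<Longrightarrow> norm h \<le> b"
    using bounded_nball[of 0 1] unfolding bounded_iff by blast
  have "AE h in ball_prob. norm h \<le> b"
    unfolding ball_prob_def using b by (intro AE_uniform_measureI) auto
  then show ?thesis by (rule that)
qed

lemma integrable_ball_prob:
  fixes f :: "real \<times> real \<Rightarrow> real"
  assumes "continuous_on UNIV f" shows "integrable ball_prob f"
proof -
  interpret prob_space ball_prob by (rule prob_space_ball_prob)
  obtain b where "AE h in ball_prob. norm h \<le> b" using AE_ball_prob_bounded by blast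
  with assms show ?thesis by (intro integrable_continuous_bounded_support[OF finite_measure_axioms] sets_ball_prob)
qed

lemma distr_ball_prob_quarter_turn: "distr ball_prob borel quarter_turn = ball_prob"
proof (rule measure_eqI)
  fix A assume "A \<in> sets (distr ball_prob borel quarter_turn)"
  then have [measurable]: "A \<in> sets borel" by simp
  have [measurable]: "quarter_turn \<in> measurable ball_prob borel"
    using measurable_quarter_turn by (simp add: measurable_cong_sets[OF sets_ball_prob])
  have "nball 0 1 \<inter> quarter_turn -` A = quarter_turn -` (nball 0 1 \<inter> A)"
    using N_turn by (auto simp: nball_def)
  moreover have "emeasure lborel (quarter_turn -` (nball 0 1 \<inter> A)) = emeasure lborel (nball 0 1 \<inter> A)"
    by (subst (2) lborel_distr_quarter_turn[symmetric], subst emeasure_distr) auto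
  ultimately show "emeasure (distr ball_prob borel quarter_turn) A = emeasure ball_prob A"
    using measurable_sets_borel[OF measurable_quarter_turn \<open>A \<in> sets borel\<close>]
    by (subst emeasure_distr) (simp_all add: ball_prob_def)
qed (simp add: sets_ball_prob)

lemma ball_prob_open_pos:
  assumes "open U" "U \<noteq> {}" "U \<subseteq> nball 0 1" shows "emeasure ball_prob U \<noteq> 0"
proof -
  have "emeasure lborel U \<noteq> 0"
    using open_not_negligible[OF assms(1,2)] assms(1) by (simp add: negligible_iff_emeasure0)
  then show ?thesis
    using assms emeasure_nball_finite[of 0 1] by (simp add: ball_prob_def Int_absorb1)
qed

end


section \<open>Measures with doubling constant at most 4\<close>

definition mollified :: "(real \<times> real) measure \<Rightarrow> (real \<times> real \<Rightarrow> real) \<Rightarrow> real \<times> real \<Rightarrow> real" where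
  "mollified M \<phi> x = (\<integral>y. \<phi> (x - y) \<partial>M)"

context quarter_turn_norm
begin

context
  fixes M :: "(real \<times> real) measure"
  assumes sets_M: "sets M = sets borel"
    and finite_nball: "\<And>x r. emeasure M (nball x r) < \<infinity>"
begin

lemma finite_on_bounded: 
  assumes "bounded A" shows "emeasure M A < \<infinity>"
proof -
  obtain r where "A \<subseteq> nball 0 r" using bounded_subset_nball[OF assms] .
  then have "emeasure M A \<le> emeasure M (nball 0 r)"
    by (rule emeasure_mono) (simp add: sets_M)
  then show ?thesis using finite_nball[of 0 r] by (rule le_less_trans)
qed

lemma sigma_finite_M: "sigma_finite_measure M"
  by (intro sigma_finite_if_finite_on_balls sets_M finite_on_bounded bounded_ball)

context
  fixes \<phi> :: "real \<times> real \<Rightarrow> real" and R :: real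
  assumes cont_\<phi>: "continuous_on UNIV \<phi>" and \<phi>_nonneg: "\<And>z. 0 \<le> \<phi> z"
    and \<phi>_support: "\<And>z. R < norm z \<Longrightarrow> \<phi> z = 0"
begin

lemma borel_measurable_\<phi>: "\<phi> \<in> borel_measurable borel"
  by (rule borel_measurable_continuous_onI[OF cont_\<phi>])

lemma \<phi>_dominated:
  obtains C where "\<And>x y b. norm x \<le> b \<Longrightarrow> norm (\<phi> (x - y)) \<le> C * indicator (cball 0 (b + R)) y"
proof -
  have "bounded (\<phi> ` cball 0 R)"
    by (intro compact_imp_bounded compact_continuous_image continuous_on_subset[OF cont_\<phi>]) auto
  then obtain C where C: "\<forall>y\<in>\<phi> ` cball 0 R. norm y \<le> C" unfolding bounded_iff by blast
  show ?thesis
  proof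
    fix x y :: "real \<times> real" and b :: real assume "norm x \<le> b"
    then have "norm y \<le> b + norm (x - y)" using norm_triangle_ineq4[of x "x - y"] by simp
    then show "norm (\<phi> (x - y)) \<le> max C 0 * indicator (cball 0 (b + R)) y"
    proof (cases "norm (x - y) \<le> R")
      case True
      then have "norm (\<phi> (x - y)) \<le> C" using C by simp
      with True \<open>norm y \<le> b + norm (x - y)\<close> show ?thesis by simp
    qed (simp add: \<phi>_support indicator_def)
  qed
qed

lemma integrable_indicator_cball: "integrable M (\<lambda>y. C * indicator (cball (0::real\<times>real) b) y :: real)"
  using finite_on_bounded[OF bounded_cball, of 0 b]
  by (intro integrable_mult_right integrable_real_indicator) (auto simp: sets_M)

lemma integrable_mollified: "integrable M (\<lambda>y. \<phi> (x - y))"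
proof -
  note [measurable_cong] = sets_M and [measurable] = borel_measurable_\<phi>
  obtain C where C: "\<And>x y b. norm x \<le> b \<Longrightarrow> norm (\<phi> (x - y)) \<le> C * indicator (cball 0 (b + R)) y"
    using \<phi>_dominated by blast
  show ?thesis
    by (rule Bochner_Integration.integrable_bound[OF integrable_indicator_cball[of C "norm x + R"]])
       (use C[of x "norm x"] in \<open>auto intro!: order_trans[OF _ abs_ge_self]\<close>)
qed

lemma mollified_nonneg: "0 \<le> mollified M \<phi> x"
  unfolding mollified_def by (intro integral_nonneg_AE AE_I2) (rule \<phi>_nonneg)

lemma ennreal_mollified: "ennreal (mollified M \<phi> x) = (\<integral>\<^sup>+y. ennreal (\<phi> (x - y)) \<partial>M)"
  unfolding mollified_def by (subst nn_integral_eq_integral[OF integrable_mollified]) (auto intro: \<phi>_nonneg)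

lemma continuous_mollified: "continuous_on UNIV (mollified M \<phi>)"
proof -
  note [measurable_cong] = sets_M and [measurable] = borel_measurable_\<phi>
  obtain C where C: "\<And>x y b. norm x \<le> b \<Longrightarrow> norm (\<phi> (x - y)) \<le> C * indicator (cball 0 (b + R)) y"
    using \<phi>_dominated by blast
  have "(\<lambda>n. mollified M \<phi> (s n)) \<longlonglongrightarrow> mollified M \<phi> a" if s: "s \<longlonglongrightarrow> a" for s a
  proof -
    obtain b where b: "\<And>n. norm (s n) \<le> b"
      using Bseq_def s convergent_imp_Bseq[OF convergentI[OF s]] by (auto simp: Bseq_def)
    show ?thesis unfolding mollified_def
    proof (rule integral_dominated_convergence[OF _ _ integrable_indicator_cball])
      have "isCont \<phi> z" for z using cont_\<phi> continuous_on_eq_continuous_at[OF open_UNIV] by blast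
      then have "(\<lambda>n. \<phi> (s n - y)) \<longlonglongrightarrow> \<phi> (a - y)" for y
        by (rule isCont_tendsto_compose) (intro tendsto_intros s)
      then show "AE y in M. (\<lambda>n. \<phi> (s n - y)) \<longlonglongrightarrow> \<phi> (a - y)" by simp
      show "AE y in M. norm (\<phi> (s n - y)) \<le> C * indicator (cball 0 (b + R)) y" for n
        using C[OF b] by simp
    qed measurable
  qed
  then show ?thesis by (simp add: continuous_on_sequentially o_def)
qed

context
  assumes doubling_4: "\<And>x r. r > 0 \<Longrightarrow> emeasure M (nball x (2 * r)) \<le> 4 * emeasure M (nball x r)"
begin

text \<open>
After exchanging integrals, the ball integral of the convolution is the integral over z of
\<phi>(z) times the M-measure of a ball centred at x - z, so the doubling inequality passes from M
to the convolution.
\<close>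

lemma mollified_nball_doubling:
  assumes "r > 0"
  shows "(\<integral>\<^sup>+h. ennreal (mollified M \<phi> (x + h)) * indicator (nball 0 (2 * r)) h \<partial>lborel)
    \<le> 4 * (\<integral>\<^sup>+h. ennreal (mollified M \<phi> (x + h)) * indicator (nball 0 r) h \<partial>lborel)"
proof -
  note [measurable_cong] = sets_M and [measurable] = borel_measurable_\<phi>
  have shift: "emeasure M (nball (x - z) r) = (\<integral>\<^sup>+y. indicator (nball 0 r) (z + y - x) \<partial>M)" for z r
  proof -
    have "z + y - x \<in> nball 0 r \<longleftrightarrow> y \<in> nball (x - z) r" for y
      using N_minus_commute[of 0 "z + y - x"] N_minus_commute[of "x - z" y]
      by (simp add: nball_def algebra_simps)
    then have "(\<integral>\<^sup>+y. indicator (nball 0 r) (z + y - x) \<partial>M) = (\<integral>\<^sup>+y. indicator (nball (x - z) r) y \<partial>M)"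
      by (simp add: indicator_def)
    then show ?thesis by (simp add: sets_M)
  qed
  have eq: "(\<integral>\<^sup>+h. ennreal (mollified M \<phi> (x + h)) * indicator (nball 0 r) h \<partial>lborel)
      = (\<integral>\<^sup>+z. ennreal (\<phi> z) * emeasure M (nball (x - z) r) \<partial>lborel)" for r
    unfolding ennreal_mollified shift by (rule nn_integral_convolution_swap[OF sigma_finite_M sets_M]) auto
  have "(\<integral>\<^sup>+z. ennreal (\<phi> z) * emeasure M (nball (x - z) (2 * r)) \<partial>lborel)
      \<le> (\<integral>\<^sup>+z. 4 * (ennreal (\<phi> z) * emeasure M (nball (x - z) r)) \<partial>lborel)"
    using mult_left_mono[OF doubling_4[OF assms]] by (intro nn_integral_mono) (simp add: mult_ac)
  also have "\<dots> = 4 * (\<integral>\<^sup>+z. ennreal (\<phi> z) * emeasure M (nball (x - z) r) \<partial>lborel)"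
  proof (rule nn_integral_cmult)
    interpret M: sigma_finite_measure M by (rule sigma_finite_M)
    show "(\<lambda>z. ennreal (\<phi> z) * emeasure M (nball (x - z) r)) \<in> borel_measurable lborel"
      unfolding shift by measurable
  qed
  finally show ?thesis unfolding eq .
qed

text \<open>
Doubling the scale multiplies the area of the ball by 4, which cancels the doubling constant.
\<close>

lemma mollified_ball_average_mono:
  assumes t: "t > 0"
  shows "(\<integral>h. mollified M \<phi> (x + (2 * t) *\<^sub>R h) \<partial>ball_prob) \<le> (\<integral>h. mollified M \<phi> (x + t *\<^sub>R h) \<partial>ball_prob)"
proof -
  have [measurable]: "mollified M \<phi> \<in> borel_measurable borel"
    by (rule borel_measurable_continuous_onI[OF continuous_mollified])
  define F where "F t = (\<integral>\<^sup>+h. ennreal (mollified M \<phi> (x + t *\<^sub>R h)) * indicator (nball 0 1) h \<partial>lborel)" for t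
  have rescale: "(\<integral>\<^sup>+h. ennreal (mollified M \<phi> (x + h)) * indicator (nball 0 t) h \<partial>lborel)
      = ennreal (t\<^sup>2) * F t" if t: "t > 0" for t
  proof -
    have "t *\<^sub>R h \<in> nball 0 t \<longleftrightarrow> h \<in> nball 0 1" for h
      using t by (simp add: nball_def N_scaleR)
    then have "indicator (nball 0 t) (t *\<^sub>R h) = (indicator (nball 0 1) h :: ennreal)" for h
      by (simp add: indicator_def)
    then show ?thesis unfolding F_def
      using t by (subst nn_integral_lborel_scale[where c = t]) (simp_all add: power2_eq_square)
  qed
  have "ennreal ((2 * t)\<^sup>2) * F (2 * t) \<le> 4 * (ennreal (t\<^sup>2) * F t)"
    using mollified_nball_doubling[OF t, of x] t by (simp only: rescale mult_pos_pos zero_less_numeral)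
  also have "\<dots> = ennreal ((2 * t)\<^sup>2) * F t"
    by (simp add: power_mult_distrib ennreal_mult mult.assoc)
  finally have "F (2 * t) \<le> F t"
    using t by (subst (asm) ennreal_mult_le_mult_iff) auto
  moreover have "ennreal (\<integral>h. mollified M \<phi> (x + t *\<^sub>R h) \<partial>ball_prob) = F t / emeasure lborel (nball 0 1)" for t
  proof -
    have "integrable ball_prob (\<lambda>h. mollified M \<phi> (x + t *\<^sub>R h))"
      by (intro integrable_ball_prob continuous_on_compose2[OF continuous_mollified] continuous_intros subset_UNIV)
    then have "ennreal (\<integral>h. mollified M \<phi> (x + t *\<^sub>R h) \<partial>ball_prob) = (\<integral>\<^sup>+h. ennreal (mollified M \<phi> (x + t *\<^sub>R h)) \<partial>ball_prob)"
      by (intro nn_integral_eq_integral[symmetric]) (auto simp: mollified_nonneg)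
    also have "\<dots> = F t / emeasure lborel (nball 0 1)"
      unfolding ball_prob_def F_def by (rule nn_integral_uniform_measure) auto
    finally show ?thesis .
  qed
  ultimately have "ennreal (\<integral>h. mollified M \<phi> (x + (2 * t) *\<^sub>R h) \<partial>ball_prob)
      \<le> ennreal (\<integral>h. mollified M \<phi> (x + t *\<^sub>R h) \<partial>ball_prob)"
    by (simp add: divide_right_mono_ennreal)
  then show ?thesis
    by (subst (asm) ennreal_le_iff) (auto intro!: integral_nonneg_AE simp: mollified_nonneg)
qed

text \<open>
The averages at the scales t / 2^k increase with k, and by continuity they tend to the value at
the centre.
\<close>

lemma mollified_supermean:
  assumes t: "t > 0"
  shows "(\<integral>h. mollified M \<phi> (x + t *\<^sub>R h) \<partial>ball_prob) \<le> mollified M \<phi> x"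
proof -
  interpret prob_space ball_prob by (rule prob_space_ball_prob)
  define A where "A s = (\<integral>h. mollified M \<phi> (x + s *\<^sub>R h) \<partial>ball_prob)" for s :: real
  have mono: "A t \<le> A (t / 2 ^ k)" for k
  proof (induction k)
    case (Suc k)
    then show ?case
      using mollified_ball_average_mono[of "t / 2 ^ Suc k" x] t by (simp add: A_def)
  qed simp
  obtain b where b: "AE h in ball_prob. norm h \<le> b" using AE_ball_prob_bounded by blast
  have "bounded (mollified M \<phi> ` cball 0 (norm x + t * b))"
    by (intro compact_imp_bounded compact_continuous_image continuous_on_subset[OF continuous_mollified]) auto
  then obtain C where C: "\<forall>y\<in>mollified M \<phi> ` cball 0 (norm x + t * b). norm y \<le> C"
    unfolding bounded_iff by blast
  have halving: "(\<lambda>k. t / 2 ^ k) \<longlonglongrightarrow> 0"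
    by (rule LIMSEQ_divide_realpow_zero) simp
  have "(\<lambda>k. A (t / 2 ^ k)) \<longlonglongrightarrow> (\<integral>h. mollified M \<phi> x \<partial>ball_prob)"
    unfolding A_def
  proof (rule integral_dominated_convergence)
    show "integrable ball_prob (\<lambda>h. C)" by simp
    show "(\<lambda>h. mollified M \<phi> (x + (t / 2 ^ k) *\<^sub>R h)) \<in> borel_measurable ball_prob" for k
      by (intro borel_measurable_integrable integrable_ball_prob continuous_on_compose2[OF continuous_mollified]
            continuous_intros subset_UNIV)
    have "(\<lambda>k. mollified M \<phi> (x + (t / 2 ^ k) *\<^sub>R h)) \<longlonglongrightarrow> mollified M \<phi> (x + 0 *\<^sub>R h)" for h
    proof (rule isCont_tendsto_compose[where g = "mollified M \<phi>"])
      show "isCont (mollified M \<phi>) (x + 0 *\<^sub>R h)"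
        using continuous_mollified continuous_on_eq_continuous_at[OF open_UNIV] by blast
    qed (intro tendsto_intros halving)
    then show "AE h in ball_prob. (\<lambda>k. mollified M \<phi> (x + (t / 2 ^ k) *\<^sub>R h)) \<longlonglongrightarrow> mollified M \<phi> x"
      by simp
    show "AE h in ball_prob. norm (mollified M \<phi> (x + (t / 2 ^ k) *\<^sub>R h)) \<le> C" for k
      using b
    proof (rule eventually_mono)
      fix h :: "real \<times> real" assume h: "norm h \<le> b"
      have "norm ((t / 2 ^ k) *\<^sub>R h) = t / 2 ^ k * norm h" using t by simp
      also have "\<dots> \<le> t * b" using t h by (intro mult_mono) (auto simp: divide_le_eq mult_le_cancel_left1)
      finally have "norm (x + (t / 2 ^ k) *\<^sub>R h) \<le> norm x + t * b" by (rule norm_triangle_le[OF add_left_mono])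
      then show "norm (mollified M \<phi> (x + (t / 2 ^ k) *\<^sub>R h)) \<le> C" using C by simp
    qed
  qed simp
  then have "(\<lambda>k. A (t / 2 ^ k)) \<longlonglongrightarrow> mollified M \<phi> x" by (simp add: prob_space)
  then have "A t \<le> mollified M \<phi> x" by (rule LIMSEQ_le_const) (use mono in blast)
  then show ?thesis by (simp add: A_def)
qed

lemma mollified_constant: "mollified M \<phi> x = mollified M \<phi> y"
proof -
  obtain \<rho> where \<rho>: "\<rho> > 0" "\<And>x. ball x \<rho> \<subseteq> nball x 1" using ball_subset_nball[of 1] by auto
  obtain b where b: "AE h in ball_prob. norm h \<le> b" using AE_ball_prob_bounded by blast
  show ?thesis
  proof (rule supermean_nonneg_imp_constant[OF prob_space_ball_prob sets_ball_prob
        distr_ball_prob_quarter_turn b _ \<rho>(1) continuous_mollified mollified_nonneg mollified_supermean])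
    show "emeasure ball_prob U \<noteq> 0" if "open U" "U \<noteq> {}" "U \<subseteq> ball 0 \<rho>" for U
      using that \<rho>(2)[of 0] by (intro ball_prob_open_pos subset_trans[OF that(3)])
  qed
qed

end

end

text \<open>
The indicator of U is the increasing limit of the kernels min 1 (n * dist(z, -U)), where -U is
the complement of U; these are continuous, vanish outside U, and have constant convolutions.
\<close>

lemma open_translate_invariant:
  assumes doubling_4: "\<And>x r. r > 0 \<Longrightarrow> emeasure M (nball x (2 * r)) \<le> 4 * emeasure M (nball x r)"
    and U: "open U" "bounded U"
  shows "emeasure M {y. x - y \<in> U} = emeasure M {y. - y \<in> U}"
proof -
  note [measurable_cong] = sets_M
  define \<phi> where "\<phi> n z = min 1 (real n * infdist z (- U))" for n and z :: "real \<times> real"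
  obtain R where R: "\<And>z. z \<in> U \<Longrightarrow> norm z \<le> R" using U(2) unfolding bounded_iff by blast
  have "- U \<noteq> {}" using U(2) not_bounded_UNIV by (metis Compl_empty_eq double_complement)
  then have infdist_pos: "infdist z (- U) > 0 \<longleftrightarrow> z \<in> U" for z
    using in_closed_iff_infdist_zero[of "- U" z] U(1) infdist_nonneg[of z "- U"] by (auto simp: less_le)
  have cont: "continuous_on UNIV (\<phi> n)" for n
    unfolding \<phi>_def by (intro continuous_intros)
  have nonneg: "0 \<le> \<phi> n z" for n z by (simp add: \<phi>_def infdist_nonneg)
  have support: "\<phi> n z = 0" if "R < norm z" for n z
  proof -
    have "z \<notin> U" using R[of z] that by auto
    then show ?thesis using infdist_pos[of z] infdist_nonneg[of z "- U"] by (simp add: \<phi>_def)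
  qed
  have mono: "incseq (\<lambda>n z. ennreal (\<phi> n z))"
    unfolding \<phi>_def incseq_def le_fun_def
    by (auto intro!: ennreal_leI min.mono mult_right_mono infdist_nonneg)
  have sup: "(SUP n. ennreal (\<phi> n z)) = indicator U z" for z
  proof (cases "z \<in> U")
    case True
    then obtain n :: nat where "1 < real n * infdist z (- U)"
      using infdist_pos reals_Archimedean3 by blast
    then have "ennreal (\<phi> n z) = 1" by (simp add: \<phi>_def)
    then have "1 \<le> (SUP n. ennreal (\<phi> n z))" by (metis SUP_upper UNIV_I)
    moreover have "(SUP n. ennreal (\<phi> n z)) \<le> 1" by (intro SUP_least) (simp add: \<phi>_def ennreal_le_1)
    ultimately show ?thesis using True by simp
  next
    case False
    then have "\<phi> n z = 0" for n
      using infdist_pos[of z] infdist_nonneg[of z "- U"] by (simp add: \<phi>_def)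
    then show ?thesis using False by simp
  qed
  have sup_mollified: "emeasure M {y. x - y \<in> U} = (SUP n. ennreal (mollified M (\<phi> n) x))" for x
  proof -
    have "open {y. x - y \<in> U}"
      using open_vimage[OF U(1), of "\<lambda>y. x - y"] by (simp add: vimage_def continuous_intros)
    then have "emeasure M {y. x - y \<in> U} = (\<integral>\<^sup>+y. indicator {y. x - y \<in> U} y \<partial>M)"
      by (subst nn_integral_indicator) (auto simp: sets_M)
    also have "\<dots> = (\<integral>\<^sup>+y. (SUP n. ennreal (\<phi> n (x - y))) \<partial>M)"
      unfolding sup by (simp add: indicator_def)
    also have "\<dots> = (SUP n. \<integral>\<^sup>+y. ennreal (\<phi> n (x - y)) \<partial>M)"
    proof (rule nn_integral_monotone_convergence_SUP)
      show "incseq (\<lambda>n y. ennreal (\<phi> n (x - y)))" using mono unfolding incseq_def le_fun_def by blast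
      fix n
      have [measurable]: "\<phi> n \<in> borel_measurable borel" by (rule borel_measurable_continuous_onI[OF cont])
      show "(\<lambda>y. ennreal (\<phi> n (x - y))) \<in> borel_measurable M" by measurable
    qed
    also have "\<dots> = (SUP n. ennreal (mollified M (\<phi> n) x))"
      by (simp add: ennreal_mollified[OF cont nonneg support])
    finally show ?thesis .
  qed
  have "mollified M (\<phi> n) x = mollified M (\<phi> n) 0" for n
    by (rule mollified_constant[OF cont nonneg support doubling_4])
  then have "emeasure M {y. x - y \<in> U} = emeasure M {y. 0 - y \<in> U}"
    unfolding sup_mollified by (simp only:)
  then show ?thesis by simp
qed

end

end


section \<open>Outer measures and Borel measures\<close>

lemma outer_measure_space_outer_measure_of:
  assumes "space M = UNIV"
  shows "outer_measure_space UNIV (outer_measure_of M)"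
  unfolding outer_measure_space_def
proof (intro conjI)
  show "positive UNIV (outer_measure_of M)" by (simp add: positive_def)
  show "increasing UNIV (outer_measure_of M)" by (simp add: increasing_def outer_measure_of_mono)
  show "countably_subadditive UNIV (outer_measure_of M)"
    unfolding countably_subadditive_def
  proof (intro allI impI)
    fix A :: "nat \<Rightarrow> 'a set"
    have "\<exists>E\<in>sets M. A i \<subseteq> E \<and> outer_measure_of M (A i) = emeasure M E" for i
      by (rule outer_measure_of_attain) (simp add: assms)
    then obtain E where E: "\<And>i. E i \<in> sets M" "\<And>i. A i \<subseteq> E i"
      "\<And>i. outer_measure_of M (A i) = emeasure M (E i)"
      by metis
    have "outer_measure_of M (\<Union>i. A i) \<le> outer_measure_of M (\<Union>i. E i)"
      using E(2) by (intro outer_measure_of_mono) blast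
    also have "\<dots> = emeasure M (\<Union>i. E i)" using E(1) by (intro outer_measure_of_eq) auto
    also have "\<dots> \<le> (\<Sum>i. emeasure M (E i))" using E(1) by (intro emeasure_subadditive_countably) auto
    finally show "outer_measure_of M (\<Union>i. A i) \<le> (\<Sum>i. outer_measure_of M (A i))" by (simp add: E(3))
  qed
qed

text \<open>
Splitting a measurable cover of T of the same measure along B gives the inequality that does
not come from subadditivity.
\<close>

lemma sets_subset_lambda_system_outer_measure_of:
  assumes "space M = UNIV"
  shows "sets M \<subseteq> lambda_system UNIV UNIV (outer_measure_of M)"
proof
  fix B assume B: "B \<in> sets M"
  have "outer_measure_of M (B \<inter> T) + outer_measure_of M ((UNIV - B) \<inter> T) = outer_measure_of M T" for T
  proof (rule antisym)
    obtain E where E: "E \<in> sets M" "T \<subseteq> E" "outer_measure_of M T = emeasure M E"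
      using outer_measure_of_attain[of T M] assms by auto
    have "outer_measure_of M (B \<inter> T) + outer_measure_of M ((UNIV - B) \<inter> T)
        \<le> outer_measure_of M (E \<inter> B) + outer_measure_of M (E - B)"
      using E(2) by (intro add_mono outer_measure_of_mono) auto
    also have "\<dots> = emeasure M (E \<inter> B) + emeasure M (E - B)" using E(1) B by simp
    also have "\<dots> = emeasure M E"
      using E(1) B by (subst plus_emeasure) (auto simp: Int_Diff_Un Un_Diff_Int)
    finally show "outer_measure_of M (B \<inter> T) + outer_measure_of M ((UNIV - B) \<inter> T) \<le> outer_measure_of M T"
      using E(3) by simp
    have "subadditive UNIV (outer_measure_of M)"
      using ring_of_sets.countably_subadditive_subadditive[of UNIV UNIV "outer_measure_of M"]
        outer_measure_space_outer_measure_of[OF assms] ring_of_sets_Pow[of UNIV]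
      by (auto simp: outer_measure_space_def)
    then have "outer_measure_of M ((B \<inter> T) \<union> ((UNIV - B) \<inter> T))
        \<le> outer_measure_of M (B \<inter> T) + outer_measure_of M ((UNIV - B) \<inter> T)"
      by (rule subadditiveD) auto
    moreover have "(B \<inter> T) \<union> ((UNIV - B) \<inter> T) = T" by auto
    ultimately show "outer_measure_of M T \<le> outer_measure_of M (B \<inter> T) + outer_measure_of M ((UNIV - B) \<inter> T)"
      by simp
  qed
  then show "B \<in> lambda_system UNIV UNIV (outer_measure_of M)" by (simp add: lambda_system_def)
qed

lemma lebesgue_outer_borel_cover:
  fixes A :: "(real \<times> real) set"
  obtains B where "B \<in> sets borel" "A \<subseteq> B" "emeasure lborel B = lebesgue_outer A"
proof -
  obtain E where E: "E \<in> sets lebesgue" "A \<subseteq> E" "lebesgue_outer A = emeasure lebesgue E"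
    using outer_measure_of_attain[of A "lebesgue"] by auto
  obtain B where B: "E \<subseteq> B" "B \<in> sets lborel" "emeasure lebesgue E = emeasure lborel B"
    using completion_upper[OF E(1)] by metis
  show ?thesis by (rule that[of B]) (use E B in auto)
qed

lemma lebesgue_outer_borel:
  assumes "A \<in> sets borel" shows "lebesgue_outer A = emeasure lborel A"
  using assms by (subst outer_measure_of_eq) auto

text \<open>
Restricting \<mu> to the Borel sets turns it into a measure, by Caratheodory's theorem.
\<close>

lemma borel_regular_emeasure:
  assumes reg: "borel_regular d \<mu>" and borel: "borel_sets_of d = sets (borel :: 'a::topological_space measure)"
  obtains M where "sets M = sets (borel :: 'a measure)" "\<And>A. A \<in> sets borel \<Longrightarrow> emeasure M A = \<mu> A"
proof
  have oms: "outer_measure_space UNIV \<mu>" and sub: "sets borel \<subseteq> lambda_system UNIV UNIV \<mu>"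
    using reg by (auto simp: borel_regular_def borel)
  interpret P: sigma_algebra "UNIV :: 'a set" UNIV
    using sigma_algebra_Pow[of "UNIV :: 'a set"] by simp
  have "measure_space UNIV (lambda_system UNIV UNIV \<mu>) \<mu>" by (rule P.caratheodory_lemma[OF oms])
  then have "positive (sets borel) \<mu>" "countably_additive (sets borel) \<mu>"
    using sub by (auto simp: measure_space_def positive_def countably_additive_def)
  then show "emeasure (measure_of UNIV (sets borel) \<mu>) A = \<mu> A" if "A \<in> sets borel" for A :: "'a set"
    using that sets.sigma_algebra_axioms[of "borel :: 'a measure"] by (intro emeasure_measure_of_sigma) auto
  show "sets (measure_of UNIV (sets borel) \<mu>) = sets (borel :: 'a measure)"
    using sets.sigma_algebra_axioms[of "borel :: 'a measure"]
    by (simp add: sigma_algebra.sigma_sets_eq)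
qed


section \<open>The doubling minimizers\<close>

context quarter_turn_norm
begin

text \<open>
The doubling inequality propagates finiteness from one ball to its concentric dilates by powers of
2, and these exhaust the plane.
\<close>

lemma doubling_measure_nball_finite:
  assumes "doubling_measure (induced_dist N) \<mu>"
  shows "\<mu> (nball x r) < \<infinity>"
proof -
  obtain C :: real where C: "C > 0" "\<And>x r. r > 0 \<Longrightarrow> \<mu> (nball x (2 * r)) \<le> ennreal C * \<mu> (nball x r)"
    using assms by (auto simp: doubling_measure_def mball_N)
  obtain x0 r0 where x0: "r0 > 0" "\<mu> (nball x0 r0) < \<infinity>"
    using assms by (auto simp: doubling_measure_def mball_N)
  have fin: "\<mu> (nball x0 (2 ^ k * r0)) < \<infinity>" for k
  proof (induction k)
    case (Suc k)
    then show ?case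
      using C(2)[of "2 ^ k * r0" x0] x0(1) by (simp add: mult.assoc ennreal_mult_less_top le_less_trans)
  qed (use x0 in simp)
  obtain k :: nat where "(r + N (x0 - x)) / r0 < 2 ^ k"
    using real_arch_pow[of 2] by auto
  then have k: "r + N (x0 - x) < 2 ^ k * r0" using x0(1) by (simp add: field_simps)
  have "nball x r \<subseteq> nball x0 (2 ^ k * r0)"
  proof
    fix y assume "y \<in> nball x r"
    then show "y \<in> nball x0 (2 ^ k * r0)"
      using k N_triangle[of "x0 - x" "x - y"] by (simp add: nball_def)
  qed
  then have "\<mu> (nball x r) \<le> \<mu> (nball x0 (2 ^ k * r0))"
    using assms by (auto simp: doubling_measure_def borel_regular_def outer_measure_space_def increasing_def)
  then show ?thesis using fin by (rule le_less_trans)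
qed

text \<open>
In the extended nonnegative reals a / 0 is infinite for a > 0 and 0 / 0 = 0. So a ball of
measure 0 is treated apart, using that its double has measure 0 as well; otherwise the
denominator is finite and nonzero and can be multiplied out.
\<close>

lemma doubling_constant_upper:
  assumes \<mu>: "doubling_measure (induced_dist N) \<mu>" and r: "r > 0"
  shows "\<mu> (nball x (2 * r)) \<le> doubling_constant (induced_dist N) \<mu> * \<mu> (nball x r)"
proof (cases "\<mu> (nball x r) = 0")
  case True
  obtain C :: real where "\<mu> (nball x (2 * r)) \<le> ennreal C * \<mu> (nball x r)"
    using \<mu> r unfolding doubling_measure_def mball_N by blast
  then show ?thesis using True by simp
next
  case False
  have "\<mu> (nball x (2 * r)) / \<mu> (nball x r) \<le> doubling_constant (induced_dist N) \<mu>"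
    unfolding doubling_constant_def mball_N using r by (intro SUP_upper2[of x] SUP_upper2[of r]) auto
  then have "\<mu> (nball x (2 * r)) / \<mu> (nball x r) * \<mu> (nball x r)
      \<le> doubling_constant (induced_dist N) \<mu> * \<mu> (nball x r)"
    by (rule mult_right_mono) simp
  moreover have "\<mu> (nball x (2 * r)) / \<mu> (nball x r) * \<mu> (nball x r) = \<mu> (nball x (2 * r))"
    using False doubling_measure_nball_finite[OF \<mu>, of x r]
    by (simp add: ennreal_divide_times ennreal_mult_divide_eq)
  ultimately show ?thesis by simp
qed

text \<open>
On Borel sets the claim is the uniqueness of translation invariant measures; the two sides agree
on all sets because each of \<mu> and Lebesgue outer measure is attained on a Borel cover.
\<close>

theorem doubling_constant_le_4_imp_lebesgue:
  assumes \<mu>: "doubling_measure (induced_dist N) \<mu>"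
    and le: "doubling_constant (induced_dist N) \<mu> \<le> 4"
  shows "\<exists>\<alpha>::real. \<alpha> > 0 \<and> \<mu> = (\<lambda>A. ennreal \<alpha> * lebesgue_outer A)"
proof -
  have reg: "borel_regular (induced_dist N) \<mu>" using \<mu> by (simp add: doubling_measure_def)
  then have mono: "A \<subseteq> B \<Longrightarrow> \<mu> A \<le> \<mu> B" for A B
    by (auto simp: borel_regular_def outer_measure_space_def increasing_def)
  obtain M where M: "sets M = sets (borel :: (real \<times> real) measure)" 
    "\<And>A. A \<in> sets borel \<Longrightarrow> emeasure M A = \<mu> A"
    using borel_regular_emeasure[OF reg borel_sets_of_N] by blast
  have fin: "emeasure M (nball x r) < \<infinity>" for x r
    using doubling_measure_nball_finite[OF \<mu>] by (simp add: M)
  have four: "emeasure M (nball x (2 * r)) \<le> 4 * emeasure M (nball x r)" if "r > 0" for x r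
    using doubling_constant_upper[OF \<mu> that, of x] mult_right_mono[OF le] by (force simp: M intro: order_trans)
  obtain x0 r0 where "0 < \<mu> (nball x0 r0)"
    using \<mu> by (auto simp: doubling_measure_def mball_N)
  then have "emeasure M (nball x0 r0) \<noteq> 0" by (simp add: M)
  then obtain \<alpha> :: real where \<alpha>: "\<alpha> > 0" "\<And>A. A \<in> sets borel \<Longrightarrow> emeasure M A = ennreal \<alpha> * emeasure lborel A"
    using translation_invariant_imp_lborel[OF M(1) finite_on_bounded[OF M(1) fin]
        open_translate_invariant[OF M(1) fin four] open_nball bounded_nball, of x0 r0] by blast
  have "\<mu> A = ennreal \<alpha> * lebesgue_outer A" for A
  proof (rule antisym)
    obtain B where B: "B \<in> sets borel" "A \<subseteq> B" "emeasure lborel B = lebesgue_outer A"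
      using lebesgue_outer_borel_cover by blast
    have "\<mu> B = ennreal \<alpha> * lebesgue_outer A"
      using M(2)[OF B(1)] \<alpha>(2)[OF B(1)] B(3) by metis
    then show "\<mu> A \<le> ennreal \<alpha> * lebesgue_outer A"
      using mono[OF B(2)] by metis
    obtain B where B: "B \<in> sets borel" "A \<subseteq> B" "\<mu> B = \<mu> A"
      using reg unfolding borel_regular_def borel_sets_of_N by blast
    have "lebesgue_outer A \<le> emeasure lborel B"
      using outer_measure_of_mono[OF B(2), of lebesgue] lebesgue_outer_borel[OF B(1)] by metis
    then have "ennreal \<alpha> * lebesgue_outer A \<le> ennreal \<alpha> * emeasure lborel B"
      by (rule mult_left_mono) simp
    then show "ennreal \<alpha> * lebesgue_outer A \<le> \<mu> A"
      using M(2)[OF B(1)] \<alpha>(2)[OF B(1)] B(3) by metis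
  qed
  then show ?thesis using \<alpha>(1) by blast
qed

text \<open>
By scaling, every ratio in the definition of the doubling constant equals 4.
\<close>

lemma doubling_lebesgue:
  assumes \<alpha>: "\<alpha> > 0"
  shows "doubling_measure (induced_dist N) (\<lambda>A. ennreal \<alpha> * lebesgue_outer A)" (is "doubling_measure _ ?\<mu>")
    and "doubling_constant (induced_dist N) (\<lambda>A. ennreal \<alpha> * lebesgue_outer A) = 4"
proof -
  have space: "space lebesgue = (UNIV :: (real \<times> real) set)" by simp
  have nball: "?\<mu> (nball x r) = ennreal \<alpha> * emeasure lborel (nball x r)" for x r
    by (simp only: lebesgue_outer_borel[OF sets_nball])
  have double: "?\<mu> (nball x (2 * r)) = 4 * ?\<mu> (nball x r)" for x r
    unfolding nball using emeasure_nball_scale[of 2 x r] by (simp add: mult.left_commute)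
  have pos: "?\<mu> (nball x r) \<noteq> 0" if "r > 0" for x r
    unfolding nball using emeasure_nball_pos[OF that] \<alpha> by simp
  have fin: "?\<mu> (nball x r) < \<infinity>" for x r
    unfolding nball using emeasure_nball_finite[of x r] by (simp add: ennreal_mult_less_top)
  have "outer_measure_space UNIV ?\<mu>"
    using outer_measure_space_outer_measure_of[OF space]
    by (auto simp: outer_measure_space_def positive_def increasing_def countably_subadditive_def
        ennreal_suminf_cmult intro!: mult_left_mono)
  moreover have "sets borel \<subseteq> lambda_system UNIV UNIV ?\<mu>"
  proof
    fix B :: "(real \<times> real) set" assume "B \<in> sets borel"
    then have "B \<in> lambda_system UNIV UNIV lebesgue_outer"
      using sets_subset_lambda_system_outer_measure_of[OF space] by auto
    then show "B \<in> lambda_system UNIV UNIV ?\<mu>"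
      by (simp add: lambda_system_def flip: distrib_left)
  qed
  moreover have "\<exists>B\<in>sets borel. A \<subseteq> B \<and> ?\<mu> B = ?\<mu> A" for A
  proof -
    obtain B where "B \<in> sets borel" "A \<subseteq> B" "emeasure lborel B = lebesgue_outer A"
      using lebesgue_outer_borel_cover by blast
    then show ?thesis using lebesgue_outer_borel[of B] by metis
  qed
  ultimately have "borel_regular (induced_dist N) ?\<mu>"
    by (simp add: borel_regular_def borel_sets_of_N)
  moreover have "\<exists>C::real. C > 0 \<and> (\<forall>x r. r > 0 \<longrightarrow> ?\<mu> (nball x (2 * r)) \<le> ennreal C * ?\<mu> (nball x r))"
    unfolding double by (intro exI[of _ 4]) simp
  moreover have "\<exists>x0 r0. r0 > 0 \<and> 0 < ?\<mu> (nball x0 r0) \<and> ?\<mu> (nball x0 r0) < \<infinity>"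
    using pos[of 1 0] fin[of 0 1] by (intro exI[of _ 0] exI[of _ 1]) (auto simp: zero_less_iff_neq_zero)
  ultimately show "doubling_measure (induced_dist N) ?\<mu>"
    unfolding doubling_measure_def mball_N by blast
  have "?\<mu> (nball x (2 * r)) / ?\<mu> (nball x r) = 4" if "r > 0" for x r
    unfolding double using pos[OF that, of x] fin[of x r] by (intro ennreal_mult_divide_eq) auto
  then show "doubling_constant (induced_dist N) ?\<mu> = 4"
    unfolding doubling_constant_def mball_N by simp
qed

text \<open>
The bound 4 on doubling constants from below is rigidity again: a measure of constant less than 4
is a multiple of Lebesgue measure, whose constant is 4.
\<close>

theorem DM_eq_lebesgue:
  "DM (induced_dist N) = {\<mu>. \<exists>\<alpha>::real. \<alpha> > 0 \<and> \<mu> = (\<lambda>A. ennreal \<alpha> * lebesgue_outer A)}"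
proof -
  have "least_doubling_constant (induced_dist N) = 4"
    unfolding least_doubling_constant_def
  proof (rule antisym)
    show "(INF \<mu>\<in>{\<mu>. doubling_measure (induced_dist N) \<mu>}. doubling_constant (induced_dist N) \<mu>) \<le> 4"
      using doubling_lebesgue[of 1] by (intro INF_lower2[of "\<lambda>A. ennreal 1 * lebesgue_outer A"]) auto
    show "4 \<le> (INF \<mu>\<in>{\<mu>. doubling_measure (induced_dist N) \<mu>}. doubling_constant (induced_dist N) \<mu>)"
    proof (rule INF_greatest)
      fix \<mu> assume "\<mu> \<in> {\<mu>. doubling_measure (induced_dist N) \<mu>}"
      then have \<mu>: "doubling_measure (induced_dist N) \<mu>" by simp
      show "4 \<le> doubling_constant (induced_dist N) \<mu>"
      proof (rule ccontr)
        assume less: "\<not> 4 \<le> doubling_constant (induced_dist N) \<mu>"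
        then have "doubling_constant (induced_dist N) \<mu> \<le> 4" by simp
        then obtain \<alpha> :: real where "\<alpha> > 0" "\<mu> = (\<lambda>A. ennreal \<alpha> * lebesgue_outer A)"
          using doubling_constant_le_4_imp_lebesgue[OF \<mu>] by blast
        with less show False using doubling_lebesgue(2)[of \<alpha>] by simp
      qed
    qed
  qed
  then show ?thesis
    unfolding DM_def using doubling_constant_le_4_imp_lebesgue doubling_lebesgue by auto
qed

end

interpretation norm_1: quarter_turn_norm norm_1
proof
  fix x y :: "real \<times> real" and c :: real
  show "norm_1 (x + y) \<le> norm_1 x + norm_1 y" by (cases x; cases y) auto
  show "norm_1 (c *\<^sub>R x) = \<bar>c\<bar> * norm_1 x" by (cases x) (auto simp: abs_mult algebra_simps)
  show "norm_1 x = 0 \<Longrightarrow> x = 0" by (cases x) (auto simp: zero_prod_def)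
  show "norm_1 (quarter_turn x) = norm_1 x" by (cases x) (auto simp: quarter_turn_def)
qed

interpretation norm_inf: quarter_turn_norm norm_inf
proof
  fix x y :: "real \<times> real" and c :: real
  show "norm_inf (x + y) \<le> norm_inf x + norm_inf y" by (cases x; cases y) auto
  show "norm_inf (c *\<^sub>R x) = \<bar>c\<bar> * norm_inf x" by (cases x) (auto simp: abs_mult max_mult_distrib_left)
  show "norm_inf x = 0 \<Longrightarrow> x = 0" by (cases x) (auto simp: zero_prod_def max_def split: if_splits)
  show "norm_inf (quarter_turn x) = norm_inf x" by (cases x) (auto simp: quarter_turn_def max.commute)
qed

theorem proposition3p2:
  shows "DM (induced_dist norm_1) = DM (induced_dist norm_inf) \<and>
         DM (induced_dist norm_inf) =
           {\<mu>. \<exists>\<alpha>::real. \<alpha> > 0 \<and> \<mu> = (\<lambda>A. ennreal \<alpha> * lebesgue_outer A)}"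
  by (simp only: norm_1.DM_eq_lebesgue norm_inf.DM_eq_lebesgue simp_thms)

end
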